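(* Let $(X,s)$ be a real metrizable topological vector space and let $d$ be a fixed metric on $X$ compatible with $s$. Let $f:X\to\overline{\mathbb R}$, $x\in X$, and $x^*\in\eth_d f(x)$. Then, for every $\eta>0$ and every $\rho>0$, there is $r\in(0,\rho)$ such that $$(f-x^* )(x)\le\inf_{u\in\overline B_d(x;r)}(f-x^* )(u)+\eta r.$$ Consequently, there is no $\alpha>0$ for which the estimate $$(f-x^* )(x)-\inf_{u\in\overline B_d(x;r)}(f-x^* )(u)\ge\alpha r$$ holds for all sufficiently small $r>0$. Thus, when $f(x)\in\mathbb R$, a functional $x^*\in X^*$ belongs to $\eth_d f(x)$ precisely when the best local descent gap of $f-x^*$ is sublinear along arbitrarily small scales, i.e. when there is a sequence $r_n>0$, $r_n\to0$, with $\bigl((f-x^* )(x)-\inf_{u\in\overline B_d(x;r_n)}(f-x^* )(u)\bigr)/r_n\to0$.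
   Context: $\overline{\mathbb R}=[-\infty,+\infty]$; $X^*$ is the topological dual and $\langle x,x^*\rangle:=x^*(x)$. A metric is compatible with $s$ if it generates $s$. $\overline B_d(x;r):=\{y\in X\mid d(x,y)\le r\}$. The function $f-x^*$ is $u\mapsto f(u)-\langle u,x^*\rangle$. Core subdifferential: for $f:X\to\overline{\mathbb R}$ and $x_0\in X$, $x_0^*\in X^*$ belongs to $\eth_d f(x_0)$ if $f(x_0)\in\mathbb R$ and there is a family $(\delta_\varepsilon)_{\varepsilon>0}\subset(0,+\infty)$ with $\limsup_{\varepsilon\downarrow0}\delta_\varepsilon/\varepsilon=+\infty$ such that $f(x_0)+\langle x-x_0,x_0^*\rangle\le f(x)+\varepsilon$ for every $\varepsilon>0$ and every $x\in\overline B_d(x_0;\delta_\varepsilon)$. If $f(x_0)\notin\mathbb R$, then $\eth_d f(x_0)=\emptyset$. *)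

theory Defs
  imports "HOL-Analysis.Analysis"
begin

(* The topology is a parameter s rather than a type class instance; the underlying vector
   space is the whole type. *)
definition topological_vector_space :: "'a::real_vector topology \<Rightarrow> bool" where
  "topological_vector_space s \<longleftrightarrow>
     topspace s = UNIV \<and>
     continuous_map (prod_topology s s) s (\<lambda>(x, y). x + y) \<and>
     continuous_map (prod_topology euclideanreal s) s (\<lambda>(c, x). c *\<^sub>R x)"

definition compatible_metric :: "'a topology \<Rightarrow> ('a \<Rightarrow> 'a \<Rightarrow> real) \<Rightarrow> bool" where
  "compatible_metric s d \<longleftrightarrow> Metric_space UNIV d \<and> Metric_space.mtopology UNIV d = s"

definition topological_dual :: "'a::real_vector topology \<Rightarrow> ('a \<Rightarrow> real) set" where
  "topological_dual s = {\<phi>. linear \<phi> \<and> continuous_map s euclideanreal \<phi>}"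

abbreviation closed_ball :: "('a \<Rightarrow> 'a \<Rightarrow> real) \<Rightarrow> 'a \<Rightarrow> real \<Rightarrow> 'a set" where
  "closed_ball d \<equiv> Metric_space.mcball UNIV d"

(* The family of radii is a total function on the reals; only its values at positive
   arguments matter. *)
definition core_subdifferential ::
  "'a::real_vector topology \<Rightarrow> ('a \<Rightarrow> 'a \<Rightarrow> real) \<Rightarrow> ('a \<Rightarrow> ereal) \<Rightarrow> 'a \<Rightarrow> ('a \<Rightarrow> real) set" where
  "core_subdifferential s d f x\<^sub>0 =
     {\<phi> \<in> topological_dual s.
        f x\<^sub>0 \<in> range ereal \<and>
        (\<exists>\<delta> :: real \<Rightarrow> real.
           (\<forall>\<epsilon>>0. \<delta> \<epsilon> > 0) \<and>
           Limsup (at_right 0) (\<lambda>\<epsilon>. ereal (\<delta> \<epsilon> / \<epsilon>)) = \<infinity> \<and>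
           (\<forall>\<epsilon>>0. \<forall>x \<in> closed_ball d x\<^sub>0 (\<delta> \<epsilon>).
              f x\<^sub>0 + ereal (\<phi> (x - x\<^sub>0)) \<le> f x + ereal \<epsilon>))}"

definition tilt :: "('a \<Rightarrow> ereal) \<Rightarrow> ('a \<Rightarrow> real) \<Rightarrow> 'a \<Rightarrow> ereal" where
  "tilt f \<phi> u = f u - ereal (\<phi> u)"

end

theory Submission
  imports Defs
begin

text \<open>
  Let \<open>f x\<close> be finite and write \<open>G r\<close> for the descent gap of \<open>f - \<phi>\<close> at \<open>x\<close>, the amount by which \<open>f - \<phi>\<close> can
  drop on the closed ball of radius \<open>r\<close>. It is nonnegative and nondecreasing in \<open>r\<close>, and since
  \<open>\<phi>\<close> is linear, the inequality required of \<open>\<delta>\<close> in the core subdifferential says exactly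
  \<open>G (\<delta> \<epsilon>) \<le> \<epsilon>\<close>. So \<open>\<delta>\<close> is a kind of inverse of \<open>G\<close>, and the requirement that \<open>\<delta> \<epsilon> / \<epsilon>\<close> be
  unbounded as \<open>\<epsilon>\<close> tends to \<open>0\<close> should mean that \<open>G r / r\<close> gets arbitrarily small at
  arbitrarily small \<open>r\<close>. From there on only the monotone function \<open>G\<close> on the half-line matters.

  One direction (\<open>threshold_radii_imp_sublinear\<close>) evaluates \<open>G\<close> at \<open>\<delta> \<epsilon>\<close>, truncated to a
  small radius because \<open>\<delta> \<epsilon>\<close> itself need not be small. For the other
  (\<open>sublinear_imp_threshold_radii\<close>), let \<open>\<delta> \<epsilon>\<close> be an almost largest radius, among those up to \<open>1\<close>,
  at which the gap is at most \<open>\<epsilon>\<close>. A radius \<open>r\<close> with \<open>G r \<le> \<eta> r\<close> competes for \<open>\<epsilon> = \<eta> r\<close>, so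
  \<open>\<delta> \<epsilon> / \<epsilon>\<close> is at least about \<open>1 / \<eta>\<close> there. The sequential form is a
  reformulation of the same smallness (\<open>sublinear_iff_sequence\<close>), and a linear lower bound
  on \<open>G\<close> contradicts it outright.
\<close>

section \<open>Functions that are sublinear along small scales\<close>

definition sublinear_at_small_scales :: "(real \<Rightarrow> ereal) \<Rightarrow> bool" where
  "sublinear_at_small_scales G \<longleftrightarrow> (\<forall>\<eta>>0. \<forall>\<rho>>0. \<exists>r\<in>{0<..<\<rho>}. G r \<le> ereal (\<eta> * r))"

definition threshold_radii :: "(real \<Rightarrow> ereal) \<Rightarrow> (real \<Rightarrow> real) \<Rightarrow> bool" where
  "threshold_radii G \<delta> \<longleftrightarrow>
     (\<forall>\<epsilon>>0. \<delta> \<epsilon> > 0) \<and> Limsup (at_right 0) (\<lambda>\<epsilon>. ereal (\<delta> \<epsilon> / \<epsilon>)) = \<infinity> \<and>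
     (\<forall>\<epsilon>>0. G (\<delta> \<epsilon>) \<le> ereal \<epsilon>)"

lemma sublinear_at_small_scalesE:
  assumes "sublinear_at_small_scales G" "\<eta> > 0" "\<rho> > 0"
  obtains r where "0 < r" "r < \<rho>" "G r \<le> ereal (\<eta> * r)"
  using assms unfolding sublinear_at_small_scales_def by fastforce

lemma Limsup_at_right_0_eq_PInf_iff:
  fixes h :: "real \<Rightarrow> real"
  shows "Limsup (at_right 0) (\<lambda>\<epsilon>. ereal (h \<epsilon>)) = \<infinity> \<longleftrightarrow> (\<forall>K. \<forall>b>0. \<exists>\<epsilon>\<in>{0<..<b}. K < h \<epsilon>)"
proof -
  have "Limsup (at_right 0) (\<lambda>\<epsilon>. ereal (h \<epsilon>)) \<noteq> \<infinity> \<longleftrightarrow> (\<exists>K. \<forall>\<^sub>F \<epsilon> in at_right 0. h \<epsilon> \<le> K)"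
  proof
    assume "Limsup (at_right 0) (\<lambda>\<epsilon>. ereal (h \<epsilon>)) \<noteq> \<infinity>"
    then obtain K where "Limsup (at_right 0) (\<lambda>\<epsilon>. ereal (h \<epsilon>)) < ereal K"
      by (metis ereal_dense2 ereal_infty_less(1))
    from Limsup_lessD[OF this] show "\<exists>K. \<forall>\<^sub>F \<epsilon> in at_right 0. h \<epsilon> \<le> K"
      by (auto intro!: exI[of _ K] elim!: eventually_mono)
  next
    assume "\<exists>K. \<forall>\<^sub>F \<epsilon> in at_right 0. h \<epsilon> \<le> K"
    then obtain K where "\<forall>\<^sub>F \<epsilon> in at_right 0. ereal (h \<epsilon>) \<le> ereal K" by auto
    then have "Limsup (at_right 0) (\<lambda>\<epsilon>. ereal (h \<epsilon>)) \<le> ereal K" by (rule Limsup_bounded)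
    then show "Limsup (at_right 0) (\<lambda>\<epsilon>. ereal (h \<epsilon>)) \<noteq> \<infinity>" by auto
  qed
  then show ?thesis
    unfolding eventually_at_right_field by (meson greaterThanLessThan_iff not_le)
qed

text \<open>
  A radius \<open>\<delta> \<epsilon>\<close> with \<open>\<delta> \<epsilon> / \<epsilon> > 1 / \<eta>\<close> satisfies \<open>G (\<delta> \<epsilon>) \<le> \<epsilon> \<le> \<eta> \<delta> \<epsilon>\<close>. If it exceeds the
  permitted scale, monotonicity lets it be cut down, which costs nothing once \<open>\<epsilon>\<close> is small
  compared with that scale.
\<close>
lemma threshold_radii_imp_sublinear:
  assumes mono: "\<And>r r'. r \<le> r' \<Longrightarrow> G r \<le> G r'" and "threshold_radii G \<delta>"
  shows "sublinear_at_small_scales G"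
  unfolding sublinear_at_small_scales_def
proof (intro allI impI)
  fix \<eta> \<rho> :: real assume pos: "\<eta> > 0" "\<rho> > 0"
  from assms(2) have \<delta>: "\<And>\<epsilon>. \<epsilon> > 0 \<Longrightarrow> \<delta> \<epsilon> > 0" "\<And>\<epsilon>. \<epsilon> > 0 \<Longrightarrow> G (\<delta> \<epsilon>) \<le> ereal \<epsilon>"
    and lim: "\<And>K b. b > 0 \<Longrightarrow> \<exists>\<epsilon>\<in>{0<..<b}. K < \<delta> \<epsilon> / \<epsilon>"
    unfolding threshold_radii_def Limsup_at_right_0_eq_PInf_iff by auto
  obtain \<epsilon> where \<epsilon>: "0 < \<epsilon>" "\<epsilon> < \<eta> * \<rho> / 2" "1 / \<eta> < \<delta> \<epsilon> / \<epsilon>"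
    using lim[of "\<eta> * \<rho> / 2" "1 / \<eta>"] pos by auto
  define r where "r = min (\<delta> \<epsilon>) (\<rho> / 2)"
  have "\<epsilon> \<le> \<eta> * r"
    using \<epsilon> pos unfolding r_def min_def by (auto simp: field_simps)
  moreover have "G r \<le> ereal \<epsilon>"
    using mono[of r "\<delta> \<epsilon>"] \<delta>(2)[OF \<epsilon>(1)] unfolding r_def by (meson min.cobounded1 order_trans)
  moreover have "r \<in> {0<..<\<rho>}"
    using \<delta>(1)[OF \<epsilon>(1)] pos unfolding r_def by auto
  ultimately show "\<exists>r\<in>{0<..<\<rho>}. G r \<le> ereal (\<eta> * r)"
    by (meson ereal_less_eq(3) order_trans)
qed

text \<open>
  The radii are chosen within a factor \<open>2\<close> of the largest admissible one, because the supremum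
  of the radii with gap at most \<open>\<epsilon>\<close> need not be attained; the cap \<open>1\<close> keeps it finite.
\<close>
lemma sublinear_imp_threshold_radii:
  assumes G: "sublinear_at_small_scales G"
  shows "\<exists>\<delta>. threshold_radii G \<delta>"
proof -
  define S where "S \<epsilon> = {r. 0 < r \<and> r \<le> 1 \<and> G r \<le> ereal \<epsilon>}" for \<epsilon>
  have "\<exists>q\<in>S \<epsilon>. \<forall>r\<in>S \<epsilon>. r \<le> 2 * q" if \<epsilon>: "\<epsilon> > 0" for \<epsilon>
  proof -
    obtain r where "0 < r" "r < min 1 \<epsilon>" "G r \<le> ereal (1 * r)"
      by (rule sublinear_at_small_scalesE[OF G, of 1 "min 1 \<epsilon>"]) (use \<epsilon> in auto)
    then have "r \<in> S \<epsilon>"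
      unfolding S_def by (auto intro: order_trans)
    moreover have bdd: "bdd_above (S \<epsilon>)"
      unfolding S_def by (auto intro!: bdd_aboveI[of _ 1])
    ultimately have "0 < Sup (S \<epsilon>)"
      using \<open>0 < r\<close> by (meson cSup_upper less_le_trans)
    then obtain q where "q \<in> S \<epsilon>" "Sup (S \<epsilon>) / 2 < q"
      using less_cSup_iff[of "S \<epsilon>" "Sup (S \<epsilon>) / 2"] \<open>r \<in> S \<epsilon>\<close> bdd by auto
    moreover have "r \<le> Sup (S \<epsilon>)" if "r \<in> S \<epsilon>" for r
      using that bdd by (rule cSup_upper)
    ultimately show ?thesis
      by (intro bexI[of _ q] ballI) (auto simp: field_simps intro: order_trans less_imp_le)
  qed
  then obtain \<delta> where \<delta>: "\<And>\<epsilon>. \<epsilon> > 0 \<Longrightarrow> \<delta> \<epsilon> \<in> S \<epsilon>" "\<And>\<epsilon> r. \<epsilon> > 0 \<Longrightarrow> r \<in> S \<epsilon> \<Longrightarrow> r \<le> 2 * \<delta> \<epsilon>"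
    by metis
  have "\<exists>\<epsilon>\<in>{0<..<b}. K < \<delta> \<epsilon> / \<epsilon>" if b: "b > 0" for K b
  proof -
    \<comment> \<open>The \<open>2\<close> makes up for \<open>\<delta> \<epsilon>\<close> being only within that factor of the largest radius.\<close>
    define \<eta> where "\<eta> = 1 / (2 * (\<bar>K\<bar> + 1))"
    have \<eta>: "0 < \<eta>" "\<eta> \<le> 1" "K < 1 / (2 * \<eta>)" unfolding \<eta>_def by (auto simp: field_simps)
    obtain r where r: "0 < r" "r < min 1 b" "G r \<le> ereal (\<eta> * r)"
      by (rule sublinear_at_small_scalesE[OF G, of \<eta> "min 1 b"]) (use b \<eta>(1) in auto)
    have "r \<le> 2 * \<delta> (\<eta> * r)"
      using r \<eta>(1) by (intro \<delta>(2)) (auto simp: S_def)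
    then have "1 / (2 * \<eta>) \<le> \<delta> (\<eta> * r) / (\<eta> * r)"
      using r(1) \<eta>(1) by (simp add: field_simps)
    moreover have "\<eta> * r < b"
      using r(1,2) \<eta>(2) mult_right_mono[of \<eta> 1 r] by linarith
    ultimately show ?thesis
      using \<eta>(1,3) r(1) by (intro bexI[of _ "\<eta> * r"]) auto
  qed
  then have "threshold_radii G \<delta>"
    using \<delta>(1) unfolding threshold_radii_def Limsup_at_right_0_eq_PInf_iff S_def by blast
  then show ?thesis by blast
qed

lemma ereal_divide_le_iff:
  fixes a :: ereal
  assumes "r > 0"
  shows "a / ereal r \<le> ereal c \<longleftrightarrow> a \<le> ereal (c * r)"
  using assms by (cases a) (auto simp: field_simps)

lemma sublinear_iff_sequence:
  assumes nonneg: "\<And>r. r > 0 \<Longrightarrow> 0 \<le> G r"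
  shows "sublinear_at_small_scales G \<longleftrightarrow>
    (\<exists>r :: nat \<Rightarrow> real. (\<forall>n. r n > 0) \<and> r \<longlonglongrightarrow> 0 \<and> (\<lambda>n. G (r n) / ereal (r n)) \<longlonglongrightarrow> 0)"
    (is "_ \<longleftrightarrow> (\<exists>r. ?P r)")
proof
  assume G: "sublinear_at_small_scales G"
  have "\<exists>r. 0 < r \<and> r < inverse (real (Suc n)) \<and> G r \<le> ereal (inverse (real (Suc n)) * r)" for n
    by (rule sublinear_at_small_scalesE[OF G, of "inverse (real (Suc n))" "inverse (real (Suc n))"])
      auto
  then obtain r where r: "\<And>n. 0 < r n" "\<And>n. r n < inverse (real (Suc n))"
      "\<And>n. G (r n) \<le> ereal (inverse (real (Suc n)) * r n)"
    by metis
  have "r \<longlonglongrightarrow> 0"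
    using r by (intro real_tendsto_sandwich[OF _ _ tendsto_const LIMSEQ_inverse_real_of_nat])
      (auto intro: always_eventually less_imp_le)
  moreover have "(\<lambda>n. G (r n) / ereal (r n)) \<longlonglongrightarrow> 0"
  proof (rule tendsto_sandwich[OF _ _ tendsto_const])
    show "(\<lambda>n. ereal (inverse (real (Suc n)))) \<longlonglongrightarrow> 0"
      using LIMSEQ_inverse_real_of_nat by (simp add: zero_ereal_def)
    show "\<forall>\<^sub>F n in sequentially. 0 \<le> G (r n) / ereal (r n)"
      using nonneg r(1) by (intro always_eventually allI) (simp add: zero_le_divide_ereal less_imp_le)
    show "\<forall>\<^sub>F n in sequentially. G (r n) / ereal (r n) \<le> ereal (inverse (real (Suc n)))"
      using r by (intro always_eventually allI) (simp only: ereal_divide_le_iff)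
  qed
  ultimately show "\<exists>r. ?P r" using r(1) by blast
next
  assume "\<exists>r. ?P r"
  then obtain r where r: "\<And>n. 0 < r n" "r \<longlonglongrightarrow> 0" "(\<lambda>n. G (r n) / ereal (r n)) \<longlonglongrightarrow> 0"
    by blast
  show "sublinear_at_small_scales G"
    unfolding sublinear_at_small_scales_def
  proof (intro allI impI)
    fix \<eta> \<rho> :: real assume "\<eta> > 0" "\<rho> > 0"
    then have "\<forall>\<^sub>F n in sequentially. r n < \<rho> \<and> G (r n) / ereal (r n) < ereal \<eta>"
      using order_tendstoD(2)[OF r(2)] order_tendstoD(2)[OF r(3)] by (simp add: eventually_conj)
    then obtain n where "r n < \<rho>" "G (r n) / ereal (r n) < ereal \<eta>"
      using eventually_happens'[OF sequentially_bot] by blast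
    then show "\<exists>r\<in>{0<..<\<rho>}. G r \<le> ereal (\<eta> * r)"
      using r(1)[of n] ereal_divide_le_iff[of "r n" "G (r n)" \<eta>] by (intro bexI[of _ "r n"]) auto
  qed
qed

lemma sublinear_imp_no_linear_lower_bound:
  assumes "sublinear_at_small_scales G" "\<alpha> > 0"
  shows "\<not> (\<forall>\<^sub>F r in at_right 0. ereal (\<alpha> * r) \<le> G r)"
proof
  assume "\<forall>\<^sub>F r in at_right 0. ereal (\<alpha> * r) \<le> G r"
  then obtain b where b: "b > 0" "\<And>r. 0 < r \<Longrightarrow> r < b \<Longrightarrow> ereal (\<alpha> * r) \<le> G r"
    unfolding eventually_at_right_field by blast
  obtain r where r: "0 < r" "r < b" "G r \<le> ereal (\<alpha> / 2 * r)"
    by (rule sublinear_at_small_scalesE[OF assms(1), of "\<alpha> / 2" b]) (use assms(2) b(1) in auto)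
  then have "ereal (\<alpha> * r) \<le> ereal (\<alpha> / 2 * r)"
    using b(2) order_trans by blast
  then show False using r(1) assms(2) by simp
qed

section \<open>The descent gap\<close>

definition descent_gap :: "('a \<Rightarrow> 'a \<Rightarrow> real) \<Rightarrow> ('a \<Rightarrow> ereal) \<Rightarrow> 'a \<Rightarrow> real \<Rightarrow> ereal" where
  "descent_gap d g x r = g x - (INF u \<in> closed_ball d x r. g u)"

lemma descent_gap_mono:
  assumes "Metric_space UNIV d" "r \<le> r'"
  shows "descent_gap d g x r \<le> descent_gap d g x r'"
  unfolding descent_gap_def
  using Metric_space.mcball_subset_concentric[OF assms]
  by (intro ereal_minus_mono INF_superset_mono) auto

lemma descent_gap_nonneg:
  assumes "Metric_space UNIV d" "\<bar>g x\<bar> \<noteq> \<infinity>" "0 \<le> r"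
  shows "0 \<le> descent_gap d g x r"
proof -
  have "x \<in> closed_ball d x r"
    using assms by (simp add: Metric_space.centre_in_mcball_iff)
  then have "(INF u \<in> closed_ball d x r. g u) \<le> g x" by (rule INF_lower)
  then show ?thesis
    using assms(2) unfolding descent_gap_def by (simp add: ereal_diff_positive)
qed

lemma descent_gap_le_iff:
  assumes "\<bar>g x\<bar> \<noteq> \<infinity>"
  shows "descent_gap d g x r \<le> ereal e \<longleftrightarrow> g x \<le> (INF u \<in> closed_ball d x r. g u) + ereal e"
  using assms unfolding descent_gap_def
  by (cases "g x"; cases "INF u \<in> closed_ball d x r. g u") (auto simp: algebra_simps)

lemma descent_gap_le_iff_pointwise:
  assumes "\<bar>g x\<bar> \<noteq> \<infinity>"
  shows "descent_gap d g x r \<le> ereal e \<longleftrightarrow> (\<forall>u \<in> closed_ball d x r. g x \<le> g u + ereal e)"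
proof -
  have *: "a \<le> b + ereal e \<longleftrightarrow> a - ereal e \<le> b" for a b :: ereal
    by (cases a; cases b) auto
  show ?thesis
    unfolding descent_gap_le_iff[of g x, OF assms] * by (rule le_INF_iff)
qed

section \<open>The core subdifferential\<close>

lemma finite_tilt: "\<bar>tilt f \<phi> x\<bar> \<noteq> \<infinity>" if "f x \<in> range ereal"
  using that unfolding tilt_def by (cases "f x") auto

lemma core_subdifferential_iff_threshold_radii:
  assumes "f x \<in> range ereal" "\<phi> \<in> topological_dual s"
  shows "\<phi> \<in> core_subdifferential s d f x \<longleftrightarrow>
         (\<exists>\<delta>. threshold_radii (descent_gap d (tilt f \<phi>) x) \<delta>)"
proof -
  have "linear \<phi>" using assms(2) unfolding topological_dual_def by blast
  have "f x + ereal (\<phi> (u - x)) \<le> f u + ereal \<epsilon> \<longleftrightarrow> tilt f \<phi> x \<le> tilt f \<phi> u + ereal \<epsilon>" for u \<epsilon>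
    unfolding tilt_def linear_diff[OF \<open>linear \<phi>\<close>]
    using assms(1) by (cases "f x"; cases "f u") (auto simp: algebra_simps)
  then show ?thesis
    unfolding core_subdifferential_def threshold_radii_def
      descent_gap_le_iff_pointwise[of "tilt f \<phi>" x, OF finite_tilt[of f x \<phi>, OF assms(1)]]
    using assms by simp
qed

lemma core_subdifferential_iff_sublinear:
  assumes "Metric_space UNIV d" "f x \<in> range ereal" "\<phi> \<in> topological_dual s"
  shows "\<phi> \<in> core_subdifferential s d f x \<longleftrightarrow>
         sublinear_at_small_scales (descent_gap d (tilt f \<phi>) x)"
  unfolding core_subdifferential_iff_threshold_radii[of f x, OF assms(2,3)]
  by (metis threshold_radii_imp_sublinear descent_gap_mono[OF assms(1)]
      sublinear_imp_threshold_radii)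

theorem corollary13:
  fixes s :: "'a::real_vector topology"
    and d :: "'a \<Rightarrow> 'a \<Rightarrow> real"
    and f :: "'a \<Rightarrow> ereal"
    and x :: 'a
  assumes "topological_vector_space s"
    and "metrizable_space s"
    and "compatible_metric s d"
  shows "(\<forall>\<phi> \<in> core_subdifferential s d f x.
            (\<forall>\<eta>>0. \<forall>\<rho>>0. \<exists>r \<in> {0<..<\<rho>}.
               tilt f \<phi> x \<le> (INF u \<in> closed_ball d x r. tilt f \<phi> u) + ereal (\<eta> * r)) \<and>
            \<not> (\<exists>\<alpha>>0. \<forall>\<^sub>F r in at_right 0.
               tilt f \<phi> x - (INF u \<in> closed_ball d x r. tilt f \<phi> u) \<ge> ereal (\<alpha> * r)))
       \<and> (f x \<in> range ereal \<longrightarrow>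
            (\<forall>\<phi> \<in> topological_dual s.
               \<phi> \<in> core_subdifferential s d f x \<longleftrightarrow>
               (\<exists>r :: nat \<Rightarrow> real. (\<forall>n. r n > 0) \<and> r \<longlonglongrightarrow> 0 \<and>
                  (\<lambda>n. (tilt f \<phi> x - (INF u \<in> closed_ball d x (r n). tilt f \<phi> u)) / ereal (r n))
                    \<longlonglongrightarrow> 0)))"
proof (intro conjI ballI impI)
  have d: "Metric_space UNIV d"
    using assms(3) unfolding compatible_metric_def by blast
  {
    fix \<phi> assume \<phi>: "\<phi> \<in> core_subdifferential s d f x"
    then have fin: "f x \<in> range ereal" and "\<phi> \<in> topological_dual s"
      unfolding core_subdifferential_def by auto
    with \<phi> have sub: "sublinear_at_small_scales (descent_gap d (tilt f \<phi>) x)"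
      using core_subdifferential_iff_sublinear[OF d] by blast
    show "\<forall>\<eta>>0. \<forall>\<rho>>0. \<exists>r \<in> {0<..<\<rho>}.
            tilt f \<phi> x \<le> (INF u \<in> closed_ball d x r. tilt f \<phi> u) + ereal (\<eta> * r)"
      using sub unfolding sublinear_at_small_scales_def
        descent_gap_le_iff[of "tilt f \<phi>" x, OF finite_tilt[of f x \<phi>, OF fin]] .
    show "\<not> (\<exists>\<alpha>>0. \<forall>\<^sub>F r in at_right 0.
            tilt f \<phi> x - (INF u \<in> closed_ball d x r. tilt f \<phi> u) \<ge> ereal (\<alpha> * r))"
      using sublinear_imp_no_linear_lower_bound[OF sub] unfolding descent_gap_def by blast
  }
  fix \<phi> assume fin: "f x \<in> range ereal" and "\<phi> \<in> topological_dual s"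
  then have "\<phi> \<in> core_subdifferential s d f x \<longleftrightarrow>
      sublinear_at_small_scales (descent_gap d (tilt f \<phi>) x)"
    by (rule core_subdifferential_iff_sublinear[OF d])
  also have "\<dots> \<longleftrightarrow> (\<exists>r :: nat \<Rightarrow> real. (\<forall>n. r n > 0) \<and> r \<longlonglongrightarrow> 0 \<and>
      (\<lambda>n. descent_gap d (tilt f \<phi>) x (r n) / ereal (r n)) \<longlonglongrightarrow> 0)"
    by (intro sublinear_iff_sequence descent_gap_nonneg d finite_tilt fin less_imp_le)
  finally show "\<phi> \<in> core_subdifferential s d f x \<longleftrightarrow>
      (\<exists>r :: nat \<Rightarrow> real. (\<forall>n. r n > 0) \<and> r \<longlonglongrightarrow> 0 \<and>
        (\<lambda>n. (tilt f \<phi> x - (INF u \<in> closed_ball d x (r n). tilt f \<phi> u)) / ereal (r n)) \<longlonglongrightarrow> 0)"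
    unfolding descent_gap_def .
qed

end
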